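(* For any $\boldsymbol\alpha=(\alpha_0,\alpha_1,\alpha_2,\alpha_3)\in[-1,+\infty)^4$ and $\boldsymbol\ell=(\ell_1,\ell_2,\ell_3)\in\mathbb{N}_0^3$, the following recurrence relations hold for the generalized Koornwinder polynomials on $\hat{\mathcal T}$: \begin{align*} \mathcal J_{\boldsymbol\ell}^{\boldsymbol\alpha}(\hat{\boldsymbol x})&=\sum_{p=0}^1\sum_{q=0}^1\sum_{r=0}^1\mathcal A^1_{p,q,r}(\boldsymbol\ell,\boldsymbol\alpha)\,\mathcal J_{\boldsymbol\ell-(p,\,q-p,\,r-q)}^{\boldsymbol\alpha+(1,0,0,0)}(\hat{\boldsymbol x}),\\ \mathcal J_{\boldsymbol\ell}^{\boldsymbol\alpha}(\hat{\boldsymbol x})&=\sum_{p=0}^1\sum_{q=0}^1\sum_{r=0}^1\mathcal A^2_{p,q,r}(\boldsymbol\ell,\boldsymbol\alpha)\,\mathcal J_{\boldsymbol\ell-(p,\,q-p,\,r-q)}^{\boldsymbol\alpha+(0,1,0,0)}(\hat{\boldsymbol x}),\\ \mathcal J_{\boldsymbol\ell}^{\boldsymbol\alpha}(\hat{\boldsymbol x})&=\sum_{q=0}^1\sum_{r=0}^1\mathcal A^3_{q,r}(\boldsymbol\ell,\boldsymbol\alpha)\,\mathcal J_{\boldsymbol\ell-(0,\,q,\,r-q)}^{\boldsymbol\alpha+(0,0,1,0)}(\hat{\boldsymbol x}),\\ \mathcal J_{\boldsymbol\ell}^{\boldsymbol\alpha}(\hat{\boldsymbol x})&=\sum_{r=0}^1\mathcal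 A^4_{r}(\boldsymbol\ell,\boldsymbol\alpha)\,\mathcal J_{\boldsymbol\ell-(0,0,r)}^{\boldsymbol\alpha+(0,0,0,1)}(\hat{\boldsymbol x}), \end{align*} where, with $A:=2\ell_1+\alpha_0+\alpha_1+1$ and $B:=2\ell_1+2\ell_2+\alpha_0+\alpha_1+\alpha_2+2$, the coefficients are as follows. $\mathcal A^1_{0,0,0}=b_{1,\ell_1}^{\alpha_0,\alpha_1}b_{1,\ell_2}^{A,\alpha_2}b_{1,\ell_3}^{B,\alpha_3}$, $\ \mathcal A^1_{0,0,1}=b_{1,\ell_1}^{\alpha_0,\alpha_1}b_{1,\ell_2}^{A,\alpha_2}b_{2,\ell_3}^{B,\alpha_3}$, $\ \mathcal A^1_{0,1,0}=b_{1,\ell_1}^{\alpha_0,\alpha_1}b_{2,\ell_2}^{A,\alpha_2}e_{2,\ell_3}^{B-1,\alpha_3}$, $\ \mathcal A^1_{0,1,1}=b_{1,\ell_1}^{\alpha_0,\alpha_1}b_{2,\ell_2}^{A,\alpha_2}e_{1,\ell_3}^{B-1,\alpha_3}$, $\ \mathcal A^1_{1,0,0}=b_{2,\ell_1}^{\alpha_0,\alpha_1}e_{2,\ell_2}^{A-1,\alpha_2}b_{1,\ell_3}^{B,\alpha_3}$, $\ \mathcal A^1_{1,0,1}=b_{2,\ell_1}^{\alpha_0,\alpha_1}e_{2,\ell_2}^{A-1,\alpha_2}b_{2,\ell_3}^{B,\alpha_3}$, $\ \mathcal A^1_{1,1,0}=b_{2,\ell_1}^{\alpha_0,\alpha_1}e_{1,\ell_2}^{A-1,\alpha_2}e_{2,\ell_3}^{B-1,\alpha_3}$,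 $\ \mathcal A^1_{1,1,1}=b_{2,\ell_1}^{\alpha_0,\alpha_1}e_{1,\ell_2}^{A-1,\alpha_2}e_{1,\ell_3}^{B-1,\alpha_3}$; $\mathcal A^2_{0,q,r}=\mathcal A^1_{0,q,r}$ for $q,r\in\{0,1\}$, and $\mathcal A^2_{1,0,0}=-b_{2,\ell_1}^{\alpha_1,\alpha_0}e_{2,\ell_2}^{A-1,\alpha_2}b_{1,\ell_3}^{B,\alpha_3}$, $\ \mathcal A^2_{1,0,1}=-b_{2,\ell_1}^{\alpha_1,\alpha_0}e_{2,\ell_2}^{A-1,\alpha_2}b_{2,\ell_3}^{B,\alpha_3}$, $\ \mathcal A^2_{1,1,0}=-b_{2,\ell_1}^{\alpha_1,\alpha_0}e_{1,\ell_2}^{A-1,\alpha_2}e_{2,\ell_3}^{B-1,\alpha_3}$, $\ \mathcal A^2_{1,1,1}=-b_{2,\ell_1}^{\alpha_1,\alpha_0}e_{1,\ell_2}^{A-1,\alpha_2}e_{1,\ell_3}^{B-1,\alpha_3}$; $\mathcal A^3_{0,0}=b_{1,\ell_2}^{A,\alpha_2}b_{1,\ell_3}^{B,\alpha_3}$, $\ \mathcal A^3_{0,1}=b_{1,\ell_2}^{A,\alpha_2}b_{2,\ell_3}^{B,\alpha_3}$, $\ \mathcal A^3_{1,0}=-b_{2,\ell_2}^{\alpha_2,A}e_{2,\ell_3}^{B-1,\alpha_3}$, $\ \mathcal A^3_{1,1}=-b_{2,\ell_2}^{\alpha_2,A}e_{1,\ell_3}^{B-1,\alpha_3}$; $\mathcal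 A^4_0=b_{1,\ell_3}^{B,\alpha_3}$, $\ \mathcal A^4_1=-b_{2,\ell_3}^{\alpha_3,B}$.
   Context: $\mathbb{N}_0=\{0,1,2,\dots\}$. Reference tetrahedron: $\hat{\mathcal T}=\{(\hat x_1,\hat x_2,\hat x_3)^{\mathsf T}: 0\le\hat x_1,\hat x_2,\hat x_3,\ \hat x_1+\hat x_2+\hat x_3\le1\}$. Generalized Jacobi polynomials. For $\alpha,\beta\ge-1$ and $k\in\mathbb{N}_0$, $$J_k^{\alpha,\beta}(z)=\sum_{j=0}^k\frac{(\alpha+j+1)_{k-j}(k+\alpha+\beta+1)_j}{j!(k-j)!}\Big(\frac{z-1}{2}\Big)^j,\quad (a)_n=a(a+1)\cdots(a+n-1),$$ except that $J_1^{-1,-1}(z):=z$. (In particular $J_0^{-1,-1}=1$ and $J_k^{-1,-1}=\frac{z-1}{2}\frac{z+1}{2}J_{k-2}^{1,1}$ for $k\ge2$.) Convention: $J_k^{\alpha,\beta}\equiv0$ for $k<0$. Generalized Koornwinder polynomials. For $\boldsymbol\alpha\in[-1,\infty)^4$, $\boldsymbol\ell\in\mathbb{N}_0^3$, $$\mathcal J_{\boldsymbol\ell}^{\boldsymbol\alpha}(\hat{\boldsymbol x})=(1-\hat x_2-\hat x_3)^{\ell_1}J_{\ell_1}^{\alpha_0,\alpha_1}\Big(\tfrac{2\hat x_1}{1-\hat x_2-\hat x_3}-1\Big)(1-\hat x_3)^{\ell_2}J_{\ell_2}^{2\ell_1+\alpha_0+\alpha_1+1,\alpha_2}\Big(\tfrac{2\hat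 x_2}{1-\hat x_3}-1\Big)J_{\ell_3}^{2\ell_1+2\ell_2+\alpha_0+\alpha_1+\alpha_2+2,\alpha_3}(2\hat x_3-1),$$ which is a polynomial in $\hat{\boldsymbol x}$. Any term containing $\mathcal J_{\boldsymbol k}^{\boldsymbol\alpha}$ with some negative index $k_i<0$ is zero (whether or not its coefficient is defined). One-dimensional coefficients, for $k\in\mathbb{N}_0$: - $(b_{1,k}^{\alpha,\beta},b_{2,k}^{\alpha,\beta})$ equals $(1,0)$ if $k=0$; $(2,-1)$ if $k=1,\alpha=\beta=-1$; otherwise $\big(\frac{k+\alpha+\beta+1}{2k+\alpha+\beta+1},-\frac{k+\beta}{2k+\alpha+\beta+1}\big)$; and $b_{1,k}^{\alpha,\beta}=b_{2,k}^{\alpha,\beta}=0$ for $k<0$. - $(e_{1,k}^{\alpha,\beta},e_{2,k}^{\alpha,\beta})$ equals $(\frac12,-\frac12)$ if $k=0,\alpha=\beta=-1$; $(0,-1)$ if $k=1,\alpha=\beta=-1$; otherwise $\big(\frac{k+\alpha+1}{2k+\alpha+\beta+2},-\frac{k+1}{2k+\alpha+\beta+2}\big)$. *)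

theory Defs
  imports "HOL-Analysis.Analysis"
begin

definition ref_tet :: "(real \<times> real \<times> real) set" where
  "ref_tet = {(x1, x2, x3). 0 \<le> x1 \<and> 0 \<le> x2 \<and> 0 \<le> x3 \<and> x1 + x2 + x3 \<le> 1}"

text \<open>Generalized Jacobi polynomials. The degree is an integer because the recurrences use the
  convention that the polynomials of negative degree vanish.\<close>

definition gjacobi :: "real \<Rightarrow> real \<Rightarrow> int \<Rightarrow> real \<Rightarrow> real" where
  "gjacobi \<alpha> \<beta> k z =
    (if k < 0 then 0
     else if k = 1 \<and> \<alpha> = -1 \<and> \<beta> = -1 then z
     else (\<Sum>j = 0..nat k.
            pochhammer (\<alpha> + real j + 1) (nat k - j) * pochhammer (real_of_int k + \<alpha> + \<beta> + 1) j
              / (fact j * fact (nat k - j)) * ((z - 1) / 2) ^ j))"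

text \<open>Generalized Koornwinder polynomials \<open>koornwinder l \<alpha> x\<close>. If some index is negative, then the
  corresponding factor \<^const>\<open>gjacobi\<close>, hence the product, is zero. The quotients are undefined where
  \<open>1 - x2 - x3 = 0\<close> or \<open>1 - x3 = 0\<close>; on \<^const>\<open>ref_tet\<close> this only happens for \<open>x1 = 0\<close> and for
  \<open>x2 = 0\<close>, respectively, and there the total division yields the value of the polynomial that the
  expression represents, see \<open>koornwinder_polynomial\<close> below.\<close>

fun koornwinder ::
  "int \<times> int \<times> int \<Rightarrow> real \<times> real \<times> real \<times> real \<Rightarrow> real \<times> real \<times> real \<Rightarrow> real" where
  "koornwinder (l1, l2, l3) (\<alpha>0, \<alpha>1, \<alpha>2, \<alpha>3) (x1, x2, x3) =
     (1 - x2 - x3) ^ nat l1 * gjacobi \<alpha>0 \<alpha>1 l1 (2 * x1 / (1 - x2 - x3) - 1)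
   * (1 - x3) ^ nat l2 * gjacobi (2 * real_of_int l1 + \<alpha>0 + \<alpha>1 + 1) \<alpha>2 l2 (2 * x2 / (1 - x3) - 1)
   * gjacobi (2 * real_of_int l1 + 2 * real_of_int l2 + \<alpha>0 + \<alpha>1 + \<alpha>2 + 2) \<alpha>3 l3 (2 * x3 - 1)"

declare koornwinder.simps [simp del]

definition b_coeffs :: "real \<Rightarrow> real \<Rightarrow> int \<Rightarrow> real \<times> real" where
  "b_coeffs \<alpha> \<beta> k =
    (if k < 0 then (0, 0)
     else if k = 0 then (1, 0)
     else if k = 1 \<and> \<alpha> = -1 \<and> \<beta> = -1 then (2, -1)
     else ((real_of_int k + \<alpha> + \<beta> + 1) / (2 * real_of_int k + \<alpha> + \<beta> + 1),
           - ((real_of_int k + \<beta>) / (2 * real_of_int k + \<alpha> + \<beta> + 1))))"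

definition e_coeffs :: "real \<Rightarrow> real \<Rightarrow> nat \<Rightarrow> real \<times> real" where
  "e_coeffs \<alpha> \<beta> k =
    (if k = 0 \<and> \<alpha> = -1 \<and> \<beta> = -1 then (1 / 2, - (1 / 2))
     else if k = 1 \<and> \<alpha> = -1 \<and> \<beta> = -1 then (0, -1)
     else ((real k + \<alpha> + 1) / (2 * real k + \<alpha> + \<beta> + 2), - ((real k + 1) / (2 * real k + \<alpha> + \<beta> + 2))))"

abbreviation b1 :: "real \<Rightarrow> real \<Rightarrow> int \<Rightarrow> real" where "b1 \<alpha> \<beta> k \<equiv> fst (b_coeffs \<alpha> \<beta> k)"
abbreviation b2 :: "real \<Rightarrow> real \<Rightarrow> int \<Rightarrow> real" where "b2 \<alpha> \<beta> k \<equiv> snd (b_coeffs \<alpha> \<beta> k)"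
abbreviation e1 :: "real \<Rightarrow> real \<Rightarrow> nat \<Rightarrow> real" where "e1 \<alpha> \<beta> k \<equiv> fst (e_coeffs \<alpha> \<beta> k)"
abbreviation e2 :: "real \<Rightarrow> real \<Rightarrow> nat \<Rightarrow> real" where "e2 \<alpha> \<beta> k \<equiv> snd (e_coeffs \<alpha> \<beta> k)"

text \<open>The three-dimensional coefficients are only meaningful for \<open>p\<close>, \<open>q\<close>, \<open>r\<close> in \<open>{0, 1}\<close>. For
  parameters \<open>\<alpha>i \<ge> -1\<close>, a denominator in them can vanish only if the coefficient belongs to a
  Koornwinder polynomial with a negative index.\<close>

fun A1 :: "nat \<times> nat \<times> nat \<Rightarrow> real \<times> real \<times> real \<times> real \<Rightarrow> nat \<Rightarrow> nat \<Rightarrow> nat \<Rightarrow> real" where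
  "A1 (l1, l2, l3) (\<alpha>0, \<alpha>1, \<alpha>2, \<alpha>3) p q r =
    (let A = 2 * real l1 + \<alpha>0 + \<alpha>1 + 1;
         B = 2 * real l1 + 2 * real l2 + \<alpha>0 + \<alpha>1 + \<alpha>2 + 2
     in if (p, q, r) = (0, 0, 0) then b1 \<alpha>0 \<alpha>1 (int l1) * b1 A \<alpha>2 (int l2) * b1 B \<alpha>3 (int l3)
        else if (p, q, r) = (0, 0, 1) then b1 \<alpha>0 \<alpha>1 (int l1) * b1 A \<alpha>2 (int l2) * b2 B \<alpha>3 (int l3)
        else if (p, q, r) = (0, 1, 0) then b1 \<alpha>0 \<alpha>1 (int l1) * b2 A \<alpha>2 (int l2) * e2 (B - 1) \<alpha>3 l3
        else if (p, q, r) = (0, 1, 1) then b1 \<alpha>0 \<alpha>1 (int l1) * b2 A \<alpha>2 (int l2) * e1 (B - 1) \<alpha>3 l3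
        else if (p, q, r) = (1, 0, 0) then b2 \<alpha>0 \<alpha>1 (int l1) * e2 (A - 1) \<alpha>2 l2 * b1 B \<alpha>3 (int l3)
        else if (p, q, r) = (1, 0, 1) then b2 \<alpha>0 \<alpha>1 (int l1) * e2 (A - 1) \<alpha>2 l2 * b2 B \<alpha>3 (int l3)
        else if (p, q, r) = (1, 1, 0) then b2 \<alpha>0 \<alpha>1 (int l1) * e1 (A - 1) \<alpha>2 l2 * e2 (B - 1) \<alpha>3 l3
        else if (p, q, r) = (1, 1, 1) then b2 \<alpha>0 \<alpha>1 (int l1) * e1 (A - 1) \<alpha>2 l2 * e1 (B - 1) \<alpha>3 l3
        else 0)"

fun A2 :: "nat \<times> nat \<times> nat \<Rightarrow> real \<times> real \<times> real \<times> real \<Rightarrow> nat \<Rightarrow> nat \<Rightarrow> nat \<Rightarrow> real" where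
  "A2 (l1, l2, l3) (\<alpha>0, \<alpha>1, \<alpha>2, \<alpha>3) p q r =
    (let A = 2 * real l1 + \<alpha>0 + \<alpha>1 + 1;
         B = 2 * real l1 + 2 * real l2 + \<alpha>0 + \<alpha>1 + \<alpha>2 + 2
     in if p = 0 then A1 (l1, l2, l3) (\<alpha>0, \<alpha>1, \<alpha>2, \<alpha>3) 0 q r
        else if (p, q, r) = (1, 0, 0) then - b2 \<alpha>1 \<alpha>0 (int l1) * e2 (A - 1) \<alpha>2 l2 * b1 B \<alpha>3 (int l3)
        else if (p, q, r) = (1, 0, 1) then - b2 \<alpha>1 \<alpha>0 (int l1) * e2 (A - 1) \<alpha>2 l2 * b2 B \<alpha>3 (int l3)
        else if (p, q, r) = (1, 1, 0) then - b2 \<alpha>1 \<alpha>0 (int l1) * e1 (A - 1) \<alpha>2 l2 * e2 (B - 1) \<alpha>3 l3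
        else if (p, q, r) = (1, 1, 1) then - b2 \<alpha>1 \<alpha>0 (int l1) * e1 (A - 1) \<alpha>2 l2 * e1 (B - 1) \<alpha>3 l3
        else 0)"

fun A3 :: "nat \<times> nat \<times> nat \<Rightarrow> real \<times> real \<times> real \<times> real \<Rightarrow> nat \<Rightarrow> nat \<Rightarrow> real" where
  "A3 (l1, l2, l3) (\<alpha>0, \<alpha>1, \<alpha>2, \<alpha>3) q r =
    (let A = 2 * real l1 + \<alpha>0 + \<alpha>1 + 1;
         B = 2 * real l1 + 2 * real l2 + \<alpha>0 + \<alpha>1 + \<alpha>2 + 2
     in if (q, r) = (0, 0) then b1 A \<alpha>2 (int l2) * b1 B \<alpha>3 (int l3)
        else if (q, r) = (0, 1) then b1 A \<alpha>2 (int l2) * b2 B \<alpha>3 (int l3)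
        else if (q, r) = (1, 0) then - b2 \<alpha>2 A (int l2) * e2 (B - 1) \<alpha>3 l3
        else if (q, r) = (1, 1) then - b2 \<alpha>2 A (int l2) * e1 (B - 1) \<alpha>3 l3
        else 0)"

fun A4 :: "nat \<times> nat \<times> nat \<Rightarrow> real \<times> real \<times> real \<times> real \<Rightarrow> nat \<Rightarrow> real" where
  "A4 (l1, l2, l3) (\<alpha>0, \<alpha>1, \<alpha>2, \<alpha>3) r =
    (let B = 2 * real l1 + 2 * real l2 + \<alpha>0 + \<alpha>1 + \<alpha>2 + 2
     in if r = 0 then b1 B \<alpha>3 (int l3)
        else if r = 1 then - b2 \<alpha>3 B (int l3)
        else 0)"

declare A1.simps [simp del] A2.simps [simp del] A3.simps [simp del] A4.simps [simp del]

text \<open>The homogenized Jacobi polynomial \<open>s ^ k * gjacobi \<alpha> \<beta> k (2 * y / s - 1)\<close>, without quotients.\<close>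

definition gjacobi_hom :: "real \<Rightarrow> real \<Rightarrow> nat \<Rightarrow> real \<Rightarrow> real \<Rightarrow> real" where
  "gjacobi_hom \<alpha> \<beta> k s y =
    (if k = 1 \<and> \<alpha> = -1 \<and> \<beta> = -1 then 2 * y - s
     else (\<Sum>j = 0..k.
            pochhammer (\<alpha> + real j + 1) (k - j) * pochhammer (real k + \<alpha> + \<beta> + 1) j
              / (fact j * fact (k - j)) * ((y - s) ^ j * s ^ (k - j))))"

lemma gjacobi_neg: "k < 0 \<Longrightarrow> gjacobi \<alpha> \<beta> k z = 0"
  by (simp only: gjacobi_def if_True)

lemma gjacobi_hom:
  assumes "s = 0 \<longrightarrow> y = 0"
  shows "s ^ k * gjacobi \<alpha> \<beta> (int k) (2 * y / s - 1) = gjacobi_hom \<alpha> \<beta> k s y"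
proof (cases "s = 0")
  case True
  with assms have "y = 0" by simp
  show ?thesis
  proof (cases "k = 0")
    case True
    then show ?thesis by (simp add: gjacobi_def gjacobi_hom_def)
  next
    case False
    have zero: "(y - s) ^ j * s ^ (k - j) = 0" if "j \<le> k" for j
      using False that \<open>s = 0\<close> \<open>y = 0\<close> by (cases "j = 0") auto
    have "gjacobi_hom \<alpha> \<beta> k s y = 0"
    proof (cases "k = 1 \<and> \<alpha> = -1 \<and> \<beta> = -1")
      case True
      then show ?thesis
        unfolding gjacobi_hom_def if_P[OF True] using \<open>s = 0\<close> \<open>y = 0\<close> by simp
    next
      case False
      show ?thesis
        unfolding gjacobi_hom_def if_not_P[OF False]
        by (intro sum.neutral ballI) (simp only: atLeastAtMost_iff zero mult_zero_right)
    qed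
    with False \<open>s = 0\<close> show ?thesis by simp
  qed
next
  case False
  have *: "s ^ k * (c * ((2 * y / s - 1 - 1) / 2) ^ j) = c * ((y - s) ^ j * s ^ (k - j))"
    if "j \<le> k" for c j
  proof -
    have "(2 * y / s - 1 - 1) / 2 = (y - s) / s"
      using False by (simp add: field_simps)
    moreover have "s ^ k = s ^ j * s ^ (k - j)"
      using that by (simp flip: power_add)
    ultimately have "s ^ k * (c * ((2 * y / s - 1 - 1) / 2) ^ j)
        = (s ^ j * s ^ (k - j)) * (c * ((y - s) ^ j / s ^ j))"
      by (simp only: power_divide)
    also have "\<dots> = c * ((y - s) ^ j * s ^ (k - j))"
      using False by simp
    finally show ?thesis .
  qed
  show ?thesis
  proof (cases "k = 1 \<and> \<alpha> = -1 \<and> \<beta> = -1")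
    case True
    then show ?thesis using False by (simp add: gjacobi_def gjacobi_hom_def field_simps)
  next
    case nspecial: False
    then have "\<not> (int k = 1 \<and> \<alpha> = -1 \<and> \<beta> = -1)" "\<not> int k < 0" by auto
    with nspecial show ?thesis
      unfolding gjacobi_def gjacobi_hom_def
      by (simp only: if_False nat_int of_int_of_nat_eq sum_distrib_left, intro sum.cong refl *) simp
  qed
qed

lemma real_polynomial_function_gjacobi_hom:
  assumes "real_polynomial_function f" "real_polynomial_function g"
  shows "real_polynomial_function (\<lambda>x. gjacobi_hom \<alpha> \<beta> k (f x) (g x))"
proof (cases "k = 1 \<and> \<alpha> = -1 \<and> \<beta> = -1")
  case True
  then show ?thesis
    unfolding gjacobi_hom_def if_P[OF True]
    by (intro real_polynomial_function_diff real_polynomial_function.intros(2,4) assms)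
next
  case False
  show ?thesis
    unfolding gjacobi_hom_def if_not_P[OF False]
    by (intro real_polynomial_function_sum finite_atLeastAtMost real_polynomial_function.intros(4)
        real_polynomial_function_power real_polynomial_function_diff assms
        real_polynomial_function.intros(2))
qed

text \<open>The polynomial \<open>P\<close> is uniquely determined by either of the two conditions.\<close>

lemma koornwinder_polynomial:
  obtains P where "real_polynomial_function P"
    and "\<And>x1 x2 x3. 1 - x2 - x3 \<noteq> 0 \<Longrightarrow> 1 - x3 \<noteq> 0 \<Longrightarrow>
           koornwinder l \<alpha> (x1, x2, x3) = P (x1, x2, x3)"
    and "\<And>x. x \<in> ref_tet \<Longrightarrow> koornwinder l \<alpha> x = P x"
proof -
  obtain l1 l2 l3 where l: "l = (l1, l2, l3)" by (cases l) auto
  obtain \<alpha>0 \<alpha>1 \<alpha>2 \<alpha>3 where \<alpha>: "\<alpha> = (\<alpha>0, \<alpha>1, \<alpha>2, \<alpha>3)" by (cases \<alpha>) auto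
  show thesis
  proof (cases "l1 < 0 \<or> l2 < 0 \<or> l3 < 0")
    case True
    then have "koornwinder l \<alpha> x = 0" for x
      by (cases x) (auto simp: l \<alpha> koornwinder.simps gjacobi_neg)
    then show thesis
      using that[of "\<lambda>_. 0"] by (simp add: real_polynomial_function.intros(2))
  next
    case False
    then obtain n1 n2 n3 where n: "l1 = int n1" "l2 = int n2" "l3 = int n3"
      by (metis nonneg_int_cases not_less)
    define P where "P = (\<lambda>x :: real \<times> real \<times> real.
        gjacobi_hom \<alpha>0 \<alpha>1 n1 (1 - fst (snd x) - snd (snd x)) (fst x)
      * gjacobi_hom (2 * real_of_int l1 + \<alpha>0 + \<alpha>1 + 1) \<alpha>2 n2 (1 - snd (snd x)) (fst (snd x))
      * gjacobi_hom (2 * real_of_int l1 + 2 * real_of_int l2 + \<alpha>0 + \<alpha>1 + \<alpha>2 + 2) \<alpha>3 n3 1 (snd (snd x)))"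
    have eq: "koornwinder l \<alpha> (x1, x2, x3) = P (x1, x2, x3)"
      if "1 - x2 - x3 = 0 \<longrightarrow> x1 = 0" "1 - x3 = 0 \<longrightarrow> x2 = 0" for x1 x2 x3
      using gjacobi_hom[OF that(1), of n1 \<alpha>0 \<alpha>1]
        gjacobi_hom[OF that(2), of n2 "2 * real_of_int l1 + \<alpha>0 + \<alpha>1 + 1" \<alpha>2]
        gjacobi_hom[of 1 x3 n3 "2 * real_of_int l1 + 2 * real_of_int l2 + \<alpha>0 + \<alpha>1 + \<alpha>2 + 2" \<alpha>3]
      by (simp add: l \<alpha> n P_def koornwinder.simps mult.assoc)
    have lin: "bounded_linear (\<lambda>x :: real \<times> real \<times> real. fst x)"
      "bounded_linear (\<lambda>x :: real \<times> real \<times> real. fst (snd x))"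
      "bounded_linear (\<lambda>x :: real \<times> real \<times> real. snd (snd x))"
      by (intro bounded_linear_intros)+
    note poly = lin[THEN real_polynomial_function.intros(1)]
    have "real_polynomial_function P"
      unfolding P_def
      by (intro real_polynomial_function.intros(4) real_polynomial_function_gjacobi_hom
          real_polynomial_function_diff poly real_polynomial_function.intros(2))
    moreover have "koornwinder l \<alpha> x = P x" if "x \<in> ref_tet" for x
      using that by (cases x) (auto simp: ref_tet_def intro!: eq)
    ultimately show thesis
      using eq by (intro that[of P]) auto
  qed
qed

end

theory Submission
  imports Defs
begin

text \<open>The Koornwinder polynomial is a product of three scaled Jacobi polynomials,
  \<open>s ^ k * J k (2 * y / s - 1)\<close> with \<open>(s, y)\<close> equal to \<open>(1 - x2 - x3, x1)\<close>, \<open>(1 - x3, x2)\<close> and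
  \<open>(1, x3)\<close>. The first parameter of each factor contains the degrees and parameters of the factors
  before it, so raising a parameter in one factor has to be propagated to all later ones. Two univariate
  relations suffice for this:

  \<^item> \<open>gjacobi_raise_left\<close>, \<open>gjacobi_raise_right\<close>: a Jacobi polynomial is a combination, with coefficients
    \<open>b1\<close> and, up to sign, \<open>b2\<close>, of the polynomials of degree \<open>k\<close> and \<open>k - 1\<close> with one parameter raised;
  \<^item> \<open>gjacobi_lower\<close>: multiplied by \<open>(1 - z) / 2\<close>, it is a combination, with coefficients \<open>e1\<close>, \<open>e2\<close>,
    of the polynomials of degree \<open>k\<close> and \<open>k + 1\<close> with the first parameter lowered.

  When a relation of the first kind is applied to one factor, the term of degree \<open>k\<close> requires the
  first parameter of the next factor to be raised by 1, which is again a relation of the first kind. In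
  the term of degree \<open>k - 1\<close> the next parameter has to change by \<open>1 - 2 = -1\<close>; but in that term scaling
  leaves over a factor \<open>s\<close>, and \<open>s\<close> is \<open>s' - y'\<close> for the pair \<open>(s', y')\<close> of the next factor, that is,
  \<open>s' * (1 - z') / 2\<close> with \<open>z' = 2 * y' / s' - 1\<close>. (On the tetrahedron this remains true where \<open>s' = 0\<close>,
  because \<open>y' = 0\<close> there.) So the relation of the second kind lowers the parameter. It leaves over a
  factor \<open>s'\<close> or increases the degree by one, and in both cases the situation recurs one
  factor further on: the leftover \<open>s'\<close> must again be absorbed by a lowering, while a degree
  increased by one, together with the parameter lowered by one, amounts to raising the
  next parameter by one.

  The indices \<open>p\<close>, \<open>q\<close>, \<open>r\<close> in the theorem record whether a factor \<open>s\<close> is left over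
  after the first, second and third step.

  The univariate relations follow by comparing coefficients at powers of \<open>(z - 1) / 2\<close>. The exceptional
  polynomial of degree 1 for \<open>\<alpha> = \<beta> = -1\<close> can occur only on the left of a raising relation,
  where it is checked separately. A lowering is only needed after a degree has dropped, so that some
  degree was positive; this makes the parameter to be lowered at least 1, and excludes both the
  exceptional polynomial and vanishing denominators.\<close>

section \<open>Coefficients of Jacobi polynomials\<close>

text \<open>The coefficients vanish above the degree, so that polynomials of different
  degrees can be expanded over a common range of summation. They are those of the generic formula, also
  for \<open>k = 1\<close> and \<open>\<alpha> = \<beta> = -1\<close>.\<close>

definition jacobi_coeff :: "real \<Rightarrow> real \<Rightarrow> nat \<Rightarrow> nat \<Rightarrow> real" where
  "jacobi_coeff \<alpha> \<beta> k j =
    (if j \<le> k then pochhammer (\<alpha> + real j + 1) (k - j) * pochhammer (real k + \<alpha> + \<beta> + 1) j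
       / (fact j * fact (k - j)) else 0)"

lemma gjacobi_eq_sum:
  assumes "k \<le> n" and "\<not> (k = 1 \<and> \<alpha> = -1 \<and> \<beta> = -1)"
  shows "gjacobi \<alpha> \<beta> (int k) z = (\<Sum>j\<le>n. jacobi_coeff \<alpha> \<beta> k j * ((z - 1) / 2) ^ j)"
proof -
  have "gjacobi \<alpha> \<beta> (int k) z = (\<Sum>j\<le>k. jacobi_coeff \<alpha> \<beta> k j * ((z - 1) / 2) ^ j)"
    using assms(2) by (auto simp: gjacobi_def jacobi_coeff_def atLeast0AtMost intro!: sum.cong)
  also have "\<dots> = (\<Sum>j\<le>n. jacobi_coeff \<alpha> \<beta> k j * ((z - 1) / 2) ^ j)"
    using assms(1) by (intro sum.mono_neutral_left) (auto simp: jacobi_coeff_def)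
  finally show ?thesis .
qed

lemma gjacobi_0 [simp]: "gjacobi \<alpha> \<beta> 0 z = 1"
  by (simp add: gjacobi_def)

lemma jacobi_coeff_top: "jacobi_coeff \<alpha> \<beta> k k = pochhammer (real k + \<alpha> + \<beta> + 1) k / fact k"
  by (simp add: jacobi_coeff_def)

lemma pochhammer_shift:
  "(t + 1) * pochhammer (t + 2) i = (t + 1 + real i) * pochhammer (t + 1) i" for t :: real
  using pochhammer_rec[of "t + 1" i] pochhammer_rec'[of "t + 1" i] by (simp add: algebra_simps)

lemma divide_fact_Suc: "(1 + real k) * x / fact (Suc k) = x / fact k"
proof -
  have "fact (Suc k) = (1 + real k) * fact k" "1 + real k \<noteq> 0" by simp_all
  then show ?thesis by (simp del: fact_Suc)
qed

text \<open>Raising a parameter or lowering the degree changes the Pochhammer symbols in the coefficient only by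
  linear factors at their ends. After the common factors \<open>P * Q / D\<close> have been extracted, the relation between
  the coefficients is, with \<open>n = m - j\<close> and \<open>u = \<alpha> + j + 1\<close>, the identity
  \<open>(2 * Suc m + \<alpha> + \<beta> + 1) * u = (u + Suc n) * (Suc m + \<alpha> + \<beta> + 1 + j) - (Suc m + \<beta>) * Suc n\<close>.
  For \<open>j = Suc m\<close> the polynomial of degree \<open>m\<close> does not contribute, and one linear factor remains.\<close>

lemma jacobi_coeff_raise_left:
  "(2 * real (Suc m) + \<alpha> + \<beta> + 1) * jacobi_coeff \<alpha> \<beta> (Suc m) j =
     (real (Suc m) + \<alpha> + \<beta> + 1) * jacobi_coeff (\<alpha> + 1) \<beta> (Suc m) j
     - (real (Suc m) + \<beta>) * jacobi_coeff (\<alpha> + 1) \<beta> m j"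
proof -
  consider n where "m = j + n" | "j = Suc m" | "j > Suc m"
    by (metis le_iff_add not_less_eq_eq not_less order_le_less)
  then show ?thesis
  proof cases
    case 1
    define P where "P = pochhammer (\<alpha> + real j + 2) n"
    define Q where "Q = pochhammer (real (Suc m) + \<alpha> + \<beta> + 1) j"
    define D where "D = (fact j * fact (Suc n) :: real)"
    have D: "D \<noteq> 0" "fact j * fact n = D / real (Suc n)" by (simp_all add: D_def)
    have 1: "jacobi_coeff \<alpha> \<beta> (Suc m) j = (\<alpha> + real j + 1) * P * Q / D"
      using 1 by (simp add: jacobi_coeff_def P_def Q_def D_def pochhammer_rec Suc_diff_le add_ac)
    have 2: "(real (Suc m) + \<alpha> + \<beta> + 1) * jacobi_coeff (\<alpha> + 1) \<beta> (Suc m) j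
      = (\<alpha> + real m + 2) * P * (real (Suc m) + \<alpha> + \<beta> + 1 + real j) * Q / D"
      using \<open>m = j + n\<close> pochhammer_shift[of "real (Suc m) + \<alpha> + \<beta>" j]
      by (simp add: jacobi_coeff_def P_def Q_def D_def pochhammer_rec' Suc_diff_le add_ac mult_ac)
    have 3: "jacobi_coeff (\<alpha> + 1) \<beta> m j = real (Suc n) * P * Q / D"
      using \<open>m = j + n\<close> D(2) by (simp add: jacobi_coeff_def P_def Q_def D add_ac)
    show ?thesis
      unfolding 1 2 3 using D(1) \<open>m = j + n\<close> by (simp add: field_simps)
  next
    case 2
    have "jacobi_coeff (\<alpha> + 1) \<beta> m j = 0" using 2 by (simp add: jacobi_coeff_def)
    then show ?thesis
      using 2 pochhammer_shift[of "real (Suc m) + \<alpha> + \<beta>" j]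
      by (simp add: jacobi_coeff_top field_simps del: of_nat_Suc)
  qed (simp add: jacobi_coeff_def)
qed

text \<open>The counterpart for \<open>\<beta>\<close>. It is the mirror image of the preceding relation under
  \<open>z \<mapsto> - z\<close>, which exchanges \<open>\<alpha>\<close> and \<open>\<beta>\<close>, but the expansion is centred at \<open>z = 1\<close>, so the
  coefficients are compared directly: here the relation left after the common factors is
  \<open>2 * Suc m + \<alpha> + \<beta> + 1 = (Suc m + \<alpha> + \<beta> + 1 + j) + (Suc m - j)\<close>.\<close>

lemma jacobi_coeff_raise_right:
  "(2 * real (Suc m) + \<alpha> + \<beta> + 1) * jacobi_coeff \<alpha> \<beta> (Suc m) j =
     (real (Suc m) + \<alpha> + \<beta> + 1) * jacobi_coeff \<alpha> (\<beta> + 1) (Suc m) j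
     + (real (Suc m) + \<alpha>) * jacobi_coeff \<alpha> (\<beta> + 1) m j"
proof -
  consider n where "m = j + n" | "j = Suc m" | "j > Suc m"
    by (metis le_iff_add not_less_eq_eq not_less order_le_less)
  then show ?thesis
  proof cases
    case 1
    define P where "P = pochhammer (\<alpha> + real j + 1) n"
    define Q where "Q = pochhammer (real (Suc m) + \<alpha> + \<beta> + 1) j"
    define D where "D = (fact j * fact (Suc n) :: real)"
    have D: "D \<noteq> 0" "fact j * fact n = D / real (Suc n)" by (simp_all add: D_def)
    have 1: "jacobi_coeff \<alpha> \<beta> (Suc m) j = (\<alpha> + real m + 1) * P * Q / D"
      using 1 by (simp add: jacobi_coeff_def P_def Q_def D_def pochhammer_rec' Suc_diff_le add_ac)
    have 2: "(real (Suc m) + \<alpha> + \<beta> + 1) * jacobi_coeff \<alpha> (\<beta> + 1) (Suc m) j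
      = (\<alpha> + real m + 1) * P * (real (Suc m) + \<alpha> + \<beta> + 1 + real j) * Q / D"
      using \<open>m = j + n\<close> pochhammer_shift[of "real (Suc m) + \<alpha> + \<beta>" j]
      by (simp add: jacobi_coeff_def P_def Q_def D_def pochhammer_rec' Suc_diff_le add_ac mult_ac)
    have 3: "jacobi_coeff \<alpha> (\<beta> + 1) m j = real (Suc n) * P * Q / D"
      using \<open>m = j + n\<close> D(2) by (simp add: jacobi_coeff_def P_def Q_def D add_ac)
    show ?thesis
      unfolding 1 2 3 using D(1) \<open>m = j + n\<close> by (simp add: field_simps)
  next
    case 2
    have "jacobi_coeff \<alpha> (\<beta> + 1) m j = 0" using 2 by (simp add: jacobi_coeff_def)
    then show ?thesis
      using 2 pochhammer_shift[of "real (Suc m) + \<alpha> + \<beta>" j]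
      by (simp add: jacobi_coeff_top field_simps del: of_nat_Suc)
  qed (simp add: jacobi_coeff_def)
qed

text \<open>Multiplication by \<open>(z - 1) / 2\<close> shifts the coefficients by one place. The next two lemmas compare
  the constant and the higher coefficients of \<open>(z - 1) / 2\<close> times a Jacobi polynomial with those of two
  Jacobi polynomials whose first parameter is smaller by one.\<close>

lemma jacobi_coeff_lower_0:
  "(real k + \<alpha> + 1) * jacobi_coeff \<alpha> \<beta> k 0 = (real k + 1) * jacobi_coeff \<alpha> \<beta> (Suc k) 0"
  by (simp add: jacobi_coeff_def pochhammer_rec' divide_fact_Suc add_ac mult_ac del: fact_Suc)

lemma jacobi_coeff_lower_Suc:
  "(2 * real k + \<alpha> + \<beta> + 2) * jacobi_coeff (\<alpha> + 1) \<beta> k i =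
     (real k + 1) * jacobi_coeff \<alpha> \<beta> (Suc k) (Suc i) - (real k + \<alpha> + 1) * jacobi_coeff \<alpha> \<beta> k (Suc i)"
proof -
  consider n where "k = Suc i + n" | "i = k" | "i > k"
    by (metis Suc_leI le_iff_add linorder_neqE_nat)
  then show ?thesis
  proof cases
    case 1
    define P where "P = pochhammer (\<alpha> + real i + 2) (Suc n)"
    define P' where "P' = pochhammer (\<alpha> + real i + 2) n"
    define Q where "Q = pochhammer (real k + \<alpha> + \<beta> + 2) i"
    define D where "D = (fact (Suc i) * fact (Suc n) :: real)"
    have P: "P = (\<alpha> + real k + 1) * P'"
      using 1 by (simp add: P_def P'_def pochhammer_rec' add_ac)
    have D: "D \<noteq> 0" "fact i * fact (Suc n) = D / real (Suc i)"
      "fact (Suc i) * fact n = D / real (Suc n)" by (simp_all add: D_def)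
    have c1: "jacobi_coeff (\<alpha> + 1) \<beta> k i = real (Suc i) * P * Q / D"
      using 1 D(2) by (simp add: jacobi_coeff_def P_def Q_def D Suc_diff_le add_ac del: fact_Suc)
    have c2: "jacobi_coeff \<alpha> \<beta> (Suc k) (Suc i) = P * (real k + \<alpha> + \<beta> + 2 + real i) * Q / D"
      using 1 by (simp add: jacobi_coeff_def P_def Q_def D_def pochhammer_rec'[of _ i] Suc_diff_le add_ac mult_ac del: fact_Suc)
    have c3: "jacobi_coeff \<alpha> \<beta> k (Suc i) = real (Suc n) * P' * (real k + \<alpha> + \<beta> + 1) * Q / D"
      using 1 D(3) by (simp add: jacobi_coeff_def P'_def Q_def D pochhammer_rec[of _ i] add_ac mult_ac del: fact_Suc)
    show ?thesis
      unfolding c1 c2 c3 P using D(1) 1 by (simp add: field_simps)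
  next
    case 2
    moreover have "jacobi_coeff \<alpha> \<beta> k (Suc i) = 0" using 2 by (simp add: jacobi_coeff_def)
    ultimately show ?thesis
      by (simp add: jacobi_coeff_top pochhammer_rec'[of _ k] divide_fact_Suc add_ac mult_ac del: fact_Suc)
  qed (simp add: jacobi_coeff_def)
qed

section \<open>Univariate relations\<close>

text \<open>For \<open>k \<ge> 1\<close> the denominator \<open>2 * k + \<alpha> + \<beta> + 1\<close> is at least \<open>1\<close>, so the relation between the
  coefficients may be divided by it. At \<open>k = 1\<close>, \<open>\<alpha> = \<beta> = -1\<close> the generic formula would yield the zero
  polynomial; the exceptional polynomial \<open>z\<close> is instead \<open>2 * ((z + 1) / 2) - 1\<close>.\<close>

lemma gjacobi_raise_left:
  assumes "-1 \<le> \<alpha>" "-1 \<le> \<beta>"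
  shows "gjacobi \<alpha> \<beta> (int k) z =
    b1 \<alpha> \<beta> (int k) * gjacobi (\<alpha> + 1) \<beta> (int k) z
    + b2 \<alpha> \<beta> (int k) * gjacobi (\<alpha> + 1) \<beta> (int k - 1) z"
proof (cases k)
  case 0
  then show ?thesis by (simp add: b_coeffs_def)
next
  case (Suc m)
  show ?thesis
  proof (cases "k = 1 \<and> \<alpha> = -1 \<and> \<beta> = -1")
    case True
    have "gjacobi 0 (-1) 1 z = (z + 1) / 2" by (simp add: gjacobi_def field_simps)
    with True show ?thesis by (simp add: b_coeffs_def) (simp add: gjacobi_def field_simps)
  next
    case False
    define d where "d = 2 * real (Suc m) + \<alpha> + \<beta> + 1"
    have d: "d > 0" using assms by (simp add: d_def)
    let ?w = "(z - 1) / 2"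
    have "d * gjacobi \<alpha> \<beta> (int k) z = (\<Sum>j\<le>k. d * jacobi_coeff \<alpha> \<beta> (Suc m) j * ?w ^ j)"
      unfolding Suc[symmetric] gjacobi_eq_sum[OF order.refl False]
      by (simp only: sum_distrib_left mult.assoc)
    also have "\<dots> = (real k + \<alpha> + \<beta> + 1) * (\<Sum>j\<le>k. jacobi_coeff (\<alpha> + 1) \<beta> k j * ?w ^ j)
        - (real k + \<beta>) * (\<Sum>j\<le>k. jacobi_coeff (\<alpha> + 1) \<beta> m j * ?w ^ j)"
      unfolding d_def jacobi_coeff_raise_left Suc
      by (simp only: sum_distrib_left left_diff_distrib sum_subtractf mult.assoc)
    also have "\<dots> = (real k + \<alpha> + \<beta> + 1) * gjacobi (\<alpha> + 1) \<beta> (int k) z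
        - (real k + \<beta>) * gjacobi (\<alpha> + 1) \<beta> (int k - 1) z"
      using assms Suc gjacobi_eq_sum[of k k "\<alpha> + 1" \<beta> z] gjacobi_eq_sum[of m k "\<alpha> + 1" \<beta> z] by simp
    finally have "gjacobi \<alpha> \<beta> (int k) z = ((real k + \<alpha> + \<beta> + 1) * gjacobi (\<alpha> + 1) \<beta> (int k) z
        - (real k + \<beta>) * gjacobi (\<alpha> + 1) \<beta> (int k - 1) z) / d"
      using d by (simp add: field_simps)
    moreover have "b_coeffs \<alpha> \<beta> (int k) = ((real k + \<alpha> + \<beta> + 1) / d, - ((real k + \<beta>) / d))"
      using False Suc by (auto simp: b_coeffs_def d_def)
    ultimately show ?thesis by (simp add: diff_divide_distrib)
  qed
qed

lemma gjacobi_raise_right: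
  assumes "-1 \<le> \<alpha>" "-1 \<le> \<beta>"
  shows "gjacobi \<alpha> \<beta> (int k) z =
    b1 \<alpha> \<beta> (int k) * gjacobi \<alpha> (\<beta> + 1) (int k) z
    - b2 \<beta> \<alpha> (int k) * gjacobi \<alpha> (\<beta> + 1) (int k - 1) z"
proof (cases k)
  case 0
  then show ?thesis by (simp add: b_coeffs_def)
next
  case (Suc m)
  show ?thesis
  proof (cases "k = 1 \<and> \<alpha> = -1 \<and> \<beta> = -1")
    case True
    have "gjacobi (-1) 0 1 z = (z - 1) / 2" by (simp add: gjacobi_def field_simps)
    with True show ?thesis by (simp add: b_coeffs_def) (simp add: gjacobi_def field_simps)
  next
    case False
    define d where "d = 2 * real (Suc m) + \<alpha> + \<beta> + 1"
    have d: "d > 0" using assms by (simp add: d_def)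
    let ?w = "(z - 1) / 2"
    have "d * gjacobi \<alpha> \<beta> (int k) z = (\<Sum>j\<le>k. d * jacobi_coeff \<alpha> \<beta> (Suc m) j * ?w ^ j)"
      unfolding Suc[symmetric] gjacobi_eq_sum[OF order.refl False]
      by (simp only: sum_distrib_left mult.assoc)
    also have "\<dots> = (real k + \<alpha> + \<beta> + 1) * (\<Sum>j\<le>k. jacobi_coeff \<alpha> (\<beta> + 1) k j * ?w ^ j)
        + (real k + \<alpha>) * (\<Sum>j\<le>k. jacobi_coeff \<alpha> (\<beta> + 1) m j * ?w ^ j)"
      unfolding d_def jacobi_coeff_raise_right Suc
      by (simp only: sum_distrib_left distrib_right sum.distrib mult.assoc)
    also have "\<dots> = (real k + \<alpha> + \<beta> + 1) * gjacobi \<alpha> (\<beta> + 1) (int k) z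
        + (real k + \<alpha>) * gjacobi \<alpha> (\<beta> + 1) (int k - 1) z"
      using assms Suc gjacobi_eq_sum[of k k \<alpha> "\<beta> + 1" z] gjacobi_eq_sum[of m k \<alpha> "\<beta> + 1" z] by simp
    finally have "gjacobi \<alpha> \<beta> (int k) z = ((real k + \<alpha> + \<beta> + 1) * gjacobi \<alpha> (\<beta> + 1) (int k) z
        + (real k + \<alpha>) * gjacobi \<alpha> (\<beta> + 1) (int k - 1) z) / d"
      using d by (simp add: field_simps)
    moreover have "b_coeffs \<alpha> \<beta> (int k) = ((real k + \<alpha> + \<beta> + 1) / d, - ((real k + \<beta>) / d))"
      "b_coeffs \<beta> \<alpha> (int k) = ((real k + \<alpha> + \<beta> + 1) / d, - ((real k + \<alpha>) / d))"
      using False Suc by (auto simp: b_coeffs_def d_def add_ac)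
    ultimately show ?thesis using d by (simp only: fst_conv snd_conv) (simp add: field_simps)
  qed
qed

text \<open>Since \<open>\<alpha> \<ge> 0\<close>, neither the exceptional Jacobi polynomial nor the exceptional values of
  \<open>e1\<close> and \<open>e2\<close> occur, and the denominator is positive.\<close>

lemma gjacobi_lower:
  assumes "0 \<le> \<alpha>" "-1 \<le> \<beta>"
  shows "(1 - z) / 2 * gjacobi (\<alpha> + 1) \<beta> (int k) z =
    e1 \<alpha> \<beta> k * gjacobi \<alpha> \<beta> (int k) z + e2 \<alpha> \<beta> k * gjacobi \<alpha> \<beta> (int k + 1) z"
proof -
  define d where "d = 2 * real k + \<alpha> + \<beta> + 2"
  have d: "d > 0" using assms by (simp add: d_def)
  let ?w = "(z - 1) / 2" let ?c = "jacobi_coeff \<alpha> \<beta>"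
  have "d * (?w * gjacobi (\<alpha> + 1) \<beta> (int k) z)
      = (\<Sum>i\<le>k. d * jacobi_coeff (\<alpha> + 1) \<beta> k i * ?w ^ Suc i)"
    using assms by (simp add: gjacobi_eq_sum[of k k] sum_distrib_left mult_ac)
  also have "\<dots> = (\<Sum>i\<le>k. ((real k + 1) * ?c (Suc k) (Suc i) - (real k + \<alpha> + 1) * ?c k (Suc i)) * ?w ^ Suc i)"
    unfolding d_def jacobi_coeff_lower_Suc ..
  also have "\<dots> = (\<Sum>j\<le>Suc k. ((real k + 1) * ?c (Suc k) j - (real k + \<alpha> + 1) * ?c k j) * ?w ^ j)"
    unfolding sum.atMost_Suc_shift by (simp only: jacobi_coeff_lower_0) simp
  also have "\<dots> = (real k + 1) * (\<Sum>j\<le>Suc k. ?c (Suc k) j * ?w ^ j)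
      - (real k + \<alpha> + 1) * (\<Sum>j\<le>Suc k. ?c k j * ?w ^ j)"
    by (simp only: sum_distrib_left left_diff_distrib sum_subtractf mult.assoc)
  also have "\<dots> = (real k + 1) * gjacobi \<alpha> \<beta> (int k + 1) z - (real k + \<alpha> + 1) * gjacobi \<alpha> \<beta> (int k) z"
    using assms gjacobi_eq_sum[of "Suc k" "Suc k" \<alpha> \<beta> z] gjacobi_eq_sum[of k "Suc k" \<alpha> \<beta> z]
    by (simp add: add.commute)
  finally have "(1 - z) / 2 * gjacobi (\<alpha> + 1) \<beta> (int k) z =
      ((real k + \<alpha> + 1) * gjacobi \<alpha> \<beta> (int k) z - (real k + 1) * gjacobi \<alpha> \<beta> (int k + 1) z) / d"
    using d by (simp add: field_simps)
  moreover have "e_coeffs \<alpha> \<beta> k = ((real k + \<alpha> + 1) / d, - ((real k + 1) / d))"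
    using assms by (auto simp: e_coeffs_def d_def)
  ultimately show ?thesis by (simp add: diff_divide_distrib)
qed

section \<open>Scaled Jacobi polynomials\<close>

definition scaled_jacobi :: "real \<Rightarrow> real \<Rightarrow> int \<Rightarrow> real \<Rightarrow> real \<Rightarrow> real" where
  "scaled_jacobi \<alpha> \<beta> k s y = s ^ nat k * gjacobi \<alpha> \<beta> k (2 * y / s - 1)"

lemma b_coeffs_0 [simp]: "b_coeffs \<alpha> \<beta> 0 = (1, 0)"
  by (simp add: b_coeffs_def)

text \<open>The polynomial of degree \<open>k - 1\<close> carries one power of \<open>s\<close> less, hence the extra factor \<open>s\<close>. For \<open>k = 0\<close>
  it is multiplied by the coefficient 0.\<close>

lemma scaled_jacobi_raise_left:
  assumes "-1 \<le> \<alpha>" "-1 \<le> \<beta>"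
  shows "scaled_jacobi \<alpha> \<beta> (int k) s y =
    b1 \<alpha> \<beta> (int k) * scaled_jacobi (\<alpha> + 1) \<beta> (int k) s y
    + b2 \<alpha> \<beta> (int k) * (s * scaled_jacobi (\<alpha> + 1) \<beta> (int k - 1) s y)"
proof -
  have "scaled_jacobi \<alpha> \<beta> (int k) s y = s ^ k * (b1 \<alpha> \<beta> (int k) * gjacobi (\<alpha> + 1) \<beta> (int k) (2 * y / s - 1)
      + b2 \<alpha> \<beta> (int k) * gjacobi (\<alpha> + 1) \<beta> (int k - 1) (2 * y / s - 1))"
    unfolding scaled_jacobi_def by (subst gjacobi_raise_left[OF assms]) simp
  then show ?thesis
    by (cases k) (simp_all add: scaled_jacobi_def nat_add_distrib algebra_simps)
qed

lemma scaled_jacobi_raise_right: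
  assumes "-1 \<le> \<alpha>" "-1 \<le> \<beta>"
  shows "scaled_jacobi \<alpha> \<beta> (int k) s y =
    b1 \<alpha> \<beta> (int k) * scaled_jacobi \<alpha> (\<beta> + 1) (int k) s y
    - b2 \<beta> \<alpha> (int k) * (s * scaled_jacobi \<alpha> (\<beta> + 1) (int k - 1) s y)"
proof -
  have "scaled_jacobi \<alpha> \<beta> (int k) s y = s ^ k * (b1 \<alpha> \<beta> (int k) * gjacobi \<alpha> (\<beta> + 1) (int k) (2 * y / s - 1)
      - b2 \<beta> \<alpha> (int k) * gjacobi \<alpha> (\<beta> + 1) (int k - 1) (2 * y / s - 1))"
    unfolding scaled_jacobi_def by (subst gjacobi_raise_right[OF assms]) simp
  then show ?thesis
    by (cases k) (simp_all add: scaled_jacobi_def nat_add_distrib algebra_simps)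
qed

text \<open>With \<open>z = 2 * y / s - 1\<close>, the multiplier \<open>s - y\<close> is \<open>s * ((1 - z) / 2)\<close>. If \<open>s = 0\<close>, both sides
  vanish: the left one because \<open>y = 0\<close>, the right one because its first
  term has the factor \<open>s\<close> and its last one is of positive degree.\<close>

lemma scaled_jacobi_lower:
  assumes "1 \<le> \<alpha>" "-1 \<le> \<beta>" "s = 0 \<longrightarrow> y = 0"
  shows "(s - y) * scaled_jacobi \<alpha> \<beta> (int k) s y =
    e1 (\<alpha> - 1) \<beta> k * (s * scaled_jacobi (\<alpha> - 1) \<beta> (int k) s y)
    + e2 (\<alpha> - 1) \<beta> k * scaled_jacobi (\<alpha> - 1) \<beta> (int k + 1) s y"
proof (cases "s = 0")
  case True
  with assms(3) show ?thesis by (simp add: scaled_jacobi_def nat_add_distrib)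
next
  case False
  define z where "z = 2 * y / s - 1"
  have "s - y = s * ((1 - z) / 2)" using False by (simp add: z_def field_simps)
  then have "(s - y) * scaled_jacobi \<alpha> \<beta> (int k) s y = s * s ^ k * ((1 - z) / 2 * gjacobi \<alpha> \<beta> (int k) z)"
    by (simp add: scaled_jacobi_def z_def)
  also have "(1 - z) / 2 * gjacobi \<alpha> \<beta> (int k) z = e1 (\<alpha> - 1) \<beta> k * gjacobi (\<alpha> - 1) \<beta> (int k) z
      + e2 (\<alpha> - 1) \<beta> k * gjacobi (\<alpha> - 1) \<beta> (int k + 1) z"
    using gjacobi_lower[of "\<alpha> - 1" \<beta> z k] assms by simp
  finally show ?thesis
    by (simp add: scaled_jacobi_def z_def nat_add_distrib algebra_simps)
qed

section \<open>The factors in the last two variables\<close>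

definition inner_factors ::
  "real \<Rightarrow> real \<Rightarrow> real \<Rightarrow> int \<Rightarrow> int \<Rightarrow> real \<Rightarrow> real \<Rightarrow> real" where
  "inner_factors A \<alpha>2 \<alpha>3 l2 l3 x2 x3 =
     scaled_jacobi A \<alpha>2 l2 (1 - x3) x2
     * scaled_jacobi (A + 2 * real_of_int l2 + \<alpha>2 + 1) \<alpha>3 l3 1 x3"

lemma koornwinder_eq_inner_factors:
  "koornwinder (l1, l2, l3) (\<alpha>0, \<alpha>1, \<alpha>2, \<alpha>3) (x1, x2, x3) =
     scaled_jacobi \<alpha>0 \<alpha>1 l1 (1 - x2 - x3) x1
     * inner_factors (2 * real_of_int l1 + \<alpha>0 + \<alpha>1 + 1) \<alpha>2 \<alpha>3 l2 l3 x2 x3"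
  by (simp add: koornwinder.simps inner_factors_def scaled_jacobi_def mult.assoc algebra_simps)

text \<open>The last step of the first three recurrences. Let the factors before the last one be expressed as \<open>c0 * S0\<close>, where
  nothing is left over, plus \<open>c1 * S1\<close> with a factor \<open>1 - y\<close> left over. The last parameter is
  raised in the former term and lowered in the latter, which absorbs \<open>1 - y\<close>. Lowering requires
  \<open>B \<ge> 1\<close>, but only if the second term is present.\<close>

lemma scaled_jacobi_split:
  assumes "-1 \<le> B" "-1 \<le> \<beta>" "c1 \<noteq> 0 \<Longrightarrow> 1 \<le> B"
  shows "(c0 * S0 + c1 * ((1 - y) * S1)) * scaled_jacobi B \<beta> (int k) 1 y =
      c0 * (b1 B \<beta> (int k) * (S0 * scaled_jacobi (B + 1) \<beta> (int k) 1 y)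
          + b2 B \<beta> (int k) * (S0 * scaled_jacobi (B + 1) \<beta> (int k - 1) 1 y))
    + c1 * (e2 (B - 1) \<beta> k * (S1 * scaled_jacobi (B - 1) \<beta> (int k + 1) 1 y)
          + e1 (B - 1) \<beta> k * (S1 * scaled_jacobi (B - 1) \<beta> (int k) 1 y))"
proof -
  define T where "T = scaled_jacobi B \<beta> (int k) 1 y"
  have raise: "T = b1 B \<beta> (int k) * scaled_jacobi (B + 1) \<beta> (int k) 1 y
      + b2 B \<beta> (int k) * scaled_jacobi (B + 1) \<beta> (int k - 1) 1 y"
    unfolding T_def by (subst scaled_jacobi_raise_left) (use assms in auto)
  have lower: "c1 * ((1 - y) * T) = c1 * (e1 (B - 1) \<beta> k * scaled_jacobi (B - 1) \<beta> (int k) 1 y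
      + e2 (B - 1) \<beta> k * scaled_jacobi (B - 1) \<beta> (int k + 1) 1 y)"
    unfolding T_def using assms scaled_jacobi_lower[of B \<beta> 1 y k] by (cases "c1 = 0") simp_all
  have "(c0 * S0 + c1 * ((1 - y) * S1)) * T = c0 * S0 * T + S1 * (c1 * ((1 - y) * T))"
    by (simp add: algebra_simps)
  also have "\<dots> = c0 * S0 * (b1 B \<beta> (int k) * scaled_jacobi (B + 1) \<beta> (int k) 1 y
      + b2 B \<beta> (int k) * scaled_jacobi (B + 1) \<beta> (int k - 1) 1 y)
    + S1 * (c1 * (e1 (B - 1) \<beta> k * scaled_jacobi (B - 1) \<beta> (int k) 1 y
      + e2 (B - 1) \<beta> k * scaled_jacobi (B - 1) \<beta> (int k + 1) 1 y))"
    unfolding lower by (subst raise) (rule refl)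
  finally show ?thesis
    unfolding T_def by (simp add: algebra_simps)
qed

text \<open>In the next three relations, \<open>B\<close> is the first parameter of the last factor. The arguments of
  \<open>F\<close> are the amounts by which the two degrees decrease; passing from \<open>A\<close> to \<open>A + 1\<close> or
  from \<open>\<alpha>2\<close> to \<open>\<alpha>2 + 1\<close> turns \<open>B\<close> into \<open>B + 1 - 2 * q\<close> if the middle degree decreases by \<open>q\<close>. For \<open>q = 1\<close>
  the coefficient is nonzero only if \<open>l2 \<ge> 1\<close>, and then \<open>B \<ge> 1\<close>, as lowering requires.\<close>

lemma inner_factors_raise_left:
  fixes l2 l3 :: nat and A \<alpha>2 \<alpha>3 x2 x3 :: real
  defines "B \<equiv> A + 2 * real l2 + \<alpha>2 + 1"
  defines "F \<equiv> \<lambda>q r. inner_factors (A + 1) \<alpha>2 \<alpha>3 (int l2 - q) (int l3 - r) x2 x3"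
  assumes "-1 \<le> A" "-1 \<le> \<alpha>2" "-1 \<le> \<alpha>3"
  shows "inner_factors A \<alpha>2 \<alpha>3 (int l2) (int l3) x2 x3 =
      b1 A \<alpha>2 (int l2) * (b1 B \<alpha>3 (int l3) * F 0 0 + b2 B \<alpha>3 (int l3) * F 0 1)
    + b2 A \<alpha>2 (int l2) * (e2 (B - 1) \<alpha>3 l3 * F 1 (-1) + e1 (B - 1) \<alpha>3 l3 * F 1 0)"
proof -
  have sj: "scaled_jacobi A \<alpha>2 (int l2) (1 - x3) x2 =
      b1 A \<alpha>2 (int l2) * scaled_jacobi (A + 1) \<alpha>2 (int l2) (1 - x3) x2
      + b2 A \<alpha>2 (int l2) * ((1 - x3) * scaled_jacobi (A + 1) \<alpha>2 (int l2 - 1) (1 - x3) x2)"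
    by (subst scaled_jacobi_raise_left) (use assms in auto)
  have F: "F 0 r = scaled_jacobi (A + 1) \<alpha>2 (int l2) (1 - x3) x2 * scaled_jacobi (B + 1) \<alpha>3 (int l3 - r) 1 x3"
    "F 1 r = scaled_jacobi (A + 1) \<alpha>2 (int l2 - 1) (1 - x3) x2 * scaled_jacobi (B - 1) \<alpha>3 (int l3 - r) 1 x3" for r
    by (simp_all add: F_def inner_factors_def B_def algebra_simps)
  have "-1 \<le> B" using assms by (simp add: B_def)
  moreover have "1 \<le> B" if "b2 A \<alpha>2 (int l2) \<noteq> 0"
    using that assms by (cases l2) (auto simp: B_def)
  ultimately show ?thesis
    unfolding F inner_factors_def sj
    using scaled_jacobi_split[of B \<alpha>3 "b2 A \<alpha>2 (int l2)" "b1 A \<alpha>2 (int l2)"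
        "scaled_jacobi (A + 1) \<alpha>2 (int l2) (1 - x3) x2" x3
        "scaled_jacobi (A + 1) \<alpha>2 (int l2 - 1) (1 - x3) x2" l3] assms
    by (simp add: B_def)
qed


lemma inner_factors_raise_right:
  fixes l2 l3 :: nat and A \<alpha>2 \<alpha>3 x2 x3 :: real
  defines "B \<equiv> A + 2 * real l2 + \<alpha>2 + 1"
  defines "F \<equiv> \<lambda>q r. inner_factors A (\<alpha>2 + 1) \<alpha>3 (int l2 - q) (int l3 - r) x2 x3"
  assumes "-1 \<le> A" "-1 \<le> \<alpha>2" "-1 \<le> \<alpha>3"
  shows "inner_factors A \<alpha>2 \<alpha>3 (int l2) (int l3) x2 x3 =
      b1 A \<alpha>2 (int l2) * (b1 B \<alpha>3 (int l3) * F 0 0 + b2 B \<alpha>3 (int l3) * F 0 1)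
    - b2 \<alpha>2 A (int l2) * (e2 (B - 1) \<alpha>3 l3 * F 1 (-1) + e1 (B - 1) \<alpha>3 l3 * F 1 0)"
proof -
  have sj: "scaled_jacobi A \<alpha>2 (int l2) (1 - x3) x2 =
      b1 A \<alpha>2 (int l2) * scaled_jacobi A (\<alpha>2 + 1) (int l2) (1 - x3) x2
      + (- b2 \<alpha>2 A (int l2)) * ((1 - x3) * scaled_jacobi A (\<alpha>2 + 1) (int l2 - 1) (1 - x3) x2)"
    by (subst scaled_jacobi_raise_right) (use assms in auto)
  have F: "F 0 r = scaled_jacobi A (\<alpha>2 + 1) (int l2) (1 - x3) x2 * scaled_jacobi (B + 1) \<alpha>3 (int l3 - r) 1 x3"
    "F 1 r = scaled_jacobi A (\<alpha>2 + 1) (int l2 - 1) (1 - x3) x2 * scaled_jacobi (B - 1) \<alpha>3 (int l3 - r) 1 x3" for r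
    by (simp_all add: F_def inner_factors_def B_def algebra_simps)
  have "-1 \<le> B" using assms by (simp add: B_def)
  moreover have "1 \<le> B" if "(- b2 \<alpha>2 A (int l2)) \<noteq> 0"
    using that assms by (cases l2) (auto simp: B_def)
  ultimately show ?thesis
    unfolding F inner_factors_def sj
    using scaled_jacobi_split[of B \<alpha>3 "(- b2 \<alpha>2 A (int l2))" "b1 A \<alpha>2 (int l2)"
        "scaled_jacobi A (\<alpha>2 + 1) (int l2) (1 - x3) x2" x3
        "scaled_jacobi A (\<alpha>2 + 1) (int l2 - 1) (1 - x3) x2" l3] assms
    by (simp add: B_def)
qed


text \<open>The multiplier \<open>1 - x2 - x3\<close> is \<open>s - y\<close> for the middle factor, whose pair is \<open>s = 1 - x3\<close>, \<open>y = x2\<close>.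
  Since \<open>A\<close> decreases by 1, \<open>B\<close> becomes \<open>B + 1\<close> if the middle degree increases and \<open>B - 1\<close> if it does not.\<close>

lemma inner_factors_lower:
  fixes l2 l3 :: nat and A \<alpha>2 \<alpha>3 x2 x3 :: real
  defines "B \<equiv> A + 2 * real l2 + \<alpha>2 + 1"
  defines "F \<equiv> \<lambda>q r. inner_factors (A - 1) \<alpha>2 \<alpha>3 (int l2 - q) (int l3 - r) x2 x3"
  assumes "1 \<le> A" "-1 \<le> \<alpha>2" "-1 \<le> \<alpha>3" "x3 = 1 \<longrightarrow> x2 = 0"
  shows "(1 - x2 - x3) * inner_factors A \<alpha>2 \<alpha>3 (int l2) (int l3) x2 x3 =
      e2 (A - 1) \<alpha>2 l2 * (b1 B \<alpha>3 (int l3) * F (-1) 0 + b2 B \<alpha>3 (int l3) * F (-1) 1)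
    + e1 (A - 1) \<alpha>2 l2 * (e2 (B - 1) \<alpha>3 l3 * F 0 (-1) + e1 (B - 1) \<alpha>3 l3 * F 0 0)"
proof -
  let ?S = "\<lambda>k. scaled_jacobi (A - 1) \<alpha>2 k (1 - x3) x2"
  have sj: "(1 - x2 - x3) * scaled_jacobi A \<alpha>2 (int l2) (1 - x3) x2 =
      e2 (A - 1) \<alpha>2 l2 * ?S (int l2 + 1) + e1 (A - 1) \<alpha>2 l2 * ((1 - x3) * ?S (int l2))"
    using scaled_jacobi_lower[of A \<alpha>2 "1 - x3" x2 l2] assms by (simp add: algebra_simps)
  have F: "F (-1) r = ?S (int l2 + 1) * scaled_jacobi (B + 1) \<alpha>3 (int l3 - r) 1 x3"
    "F 0 r = ?S (int l2) * scaled_jacobi (B - 1) \<alpha>3 (int l3 - r) 1 x3" for r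
    by (simp_all add: F_def inner_factors_def B_def algebra_simps)
  have "1 \<le> B" using assms by (simp add: B_def)
  then show ?thesis
    unfolding F inner_factors_def mult.assoc[symmetric] sj
    using scaled_jacobi_split[of B \<alpha>3 "e1 (A - 1) \<alpha>2 l2" "e2 (A - 1) \<alpha>2 l2"
        "?S (int l2 + 1)" x3 "?S (int l2)" l3] assms
    by (simp add: B_def mult.assoc)
qed

section \<open>Recurrence relations for Koornwinder polynomials\<close>

theorem lemmaA1:
  fixes \<alpha>0 \<alpha>1 \<alpha>2 \<alpha>3 :: real and l1 l2 l3 :: nat and x :: "real \<times> real \<times> real"
  assumes "-1 \<le> \<alpha>0" "-1 \<le> \<alpha>1" "-1 \<le> \<alpha>2" "-1 \<le> \<alpha>3"
    and "x \<in> ref_tet"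
  shows "koornwinder (int l1, int l2, int l3) (\<alpha>0, \<alpha>1, \<alpha>2, \<alpha>3) x =
      (\<Sum>p = 0..1. \<Sum>q = 0..1. \<Sum>r = 0..1.
         A1 (l1, l2, l3) (\<alpha>0, \<alpha>1, \<alpha>2, \<alpha>3) p q r *
         koornwinder (int l1 - int p, int l2 - (int q - int p), int l3 - (int r - int q))
           (\<alpha>0 + 1, \<alpha>1, \<alpha>2, \<alpha>3) x)
    \<and> koornwinder (int l1, int l2, int l3) (\<alpha>0, \<alpha>1, \<alpha>2, \<alpha>3) x =
      (\<Sum>p = 0..1. \<Sum>q = 0..1. \<Sum>r = 0..1.
         A2 (l1, l2, l3) (\<alpha>0, \<alpha>1, \<alpha>2, \<alpha>3) p q r *
         koornwinder (int l1 - int p, int l2 - (int q - int p), int l3 - (int r - int q))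
           (\<alpha>0, \<alpha>1 + 1, \<alpha>2, \<alpha>3) x)
    \<and> koornwinder (int l1, int l2, int l3) (\<alpha>0, \<alpha>1, \<alpha>2, \<alpha>3) x =
      (\<Sum>q = 0..1. \<Sum>r = 0..1.
         A3 (l1, l2, l3) (\<alpha>0, \<alpha>1, \<alpha>2, \<alpha>3) q r *
         koornwinder (int l1, int l2 - int q, int l3 - (int r - int q))
           (\<alpha>0, \<alpha>1, \<alpha>2 + 1, \<alpha>3) x)
    \<and> koornwinder (int l1, int l2, int l3) (\<alpha>0, \<alpha>1, \<alpha>2, \<alpha>3) x =
      (\<Sum>r = 0..1.
         A4 (l1, l2, l3) (\<alpha>0, \<alpha>1, \<alpha>2, \<alpha>3) r *
         koornwinder (int l1, int l2, int l3 - int r) (\<alpha>0, \<alpha>1, \<alpha>2, \<alpha>3 + 1) x)"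
proof -
  obtain x1 x2 x3 where x: "x = (x1, x2, x3)" by (cases x) auto
  have vertex: "x3 = 1 \<longrightarrow> x2 = 0"
    using assms(5) by (auto simp: ref_tet_def x)
  define A where "A = 2 * real l1 + \<alpha>0 + \<alpha>1 + 1"
  define B where "B = 2 * real l1 + 2 * real l2 + \<alpha>0 + \<alpha>1 + \<alpha>2 + 2"
  have B: "A + 2 * real l2 + \<alpha>2 + 1 = B" by (simp add: A_def B_def)
  have A: "-1 \<le> A" using assms by (simp add: A_def)
  define F where "F = (\<lambda>A \<alpha>2 l2 l3. inner_factors A \<alpha>2 \<alpha>3 l2 l3 x2 x3)"
  have left: "F A \<alpha>2 (int l2) (int l3) =
      b1 A \<alpha>2 (int l2) * (b1 B \<alpha>3 (int l3) * F (A + 1) \<alpha>2 (int l2) (int l3)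
                         + b2 B \<alpha>3 (int l3) * F (A + 1) \<alpha>2 (int l2) (int l3 - 1))
    + b2 A \<alpha>2 (int l2) * (e2 (B - 1) \<alpha>3 l3 * F (A + 1) \<alpha>2 (int l2 - 1) (int l3 + 1)
                         + e1 (B - 1) \<alpha>3 l3 * F (A + 1) \<alpha>2 (int l2 - 1) (int l3))"
    using inner_factors_raise_left[of A \<alpha>2 \<alpha>3 l2 l3 x2 x3] A assms by (simp add: B F_def)
  have right: "F A \<alpha>2 (int l2) (int l3) =
      b1 A \<alpha>2 (int l2) * (b1 B \<alpha>3 (int l3) * F A (\<alpha>2 + 1) (int l2) (int l3)
                         + b2 B \<alpha>3 (int l3) * F A (\<alpha>2 + 1) (int l2) (int l3 - 1))
    - b2 \<alpha>2 A (int l2) * (e2 (B - 1) \<alpha>3 l3 * F A (\<alpha>2 + 1) (int l2 - 1) (int l3 + 1)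
                         + e1 (B - 1) \<alpha>3 l3 * F A (\<alpha>2 + 1) (int l2 - 1) (int l3))"
    using inner_factors_raise_right[of A \<alpha>2 \<alpha>3 l2 l3 x2 x3] A assms by (simp add: B F_def)
  \<comment> \<open>Lowering needs \<open>A \<ge> 1\<close>, which may fail if \<open>l1 = 0\<close>; but then the coefficient \<open>c\<close> in front, \<open>b2\<close>
    for the degree \<open>l1\<close> up to sign, vanishes.\<close>
  have lower: "c * ((1 - x2 - x3) * F A \<alpha>2 (int l2) (int l3)) = c * (
      e2 (A - 1) \<alpha>2 l2 * (b1 B \<alpha>3 (int l3) * F (A - 1) \<alpha>2 (int l2 + 1) (int l3)
                         + b2 B \<alpha>3 (int l3) * F (A - 1) \<alpha>2 (int l2 + 1) (int l3 - 1))
    + e1 (A - 1) \<alpha>2 l2 * (e2 (B - 1) \<alpha>3 l3 * F (A - 1) \<alpha>2 (int l2) (int l3 + 1)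
                         + e1 (B - 1) \<alpha>3 l3 * F (A - 1) \<alpha>2 (int l2) (int l3)))"
    if "l1 = 0 \<Longrightarrow> c = 0" for c
  proof (cases l1)
    case (Suc m)
    then have "1 \<le> A" using assms by (simp add: A_def)
    then show ?thesis
      using inner_factors_lower[of A \<alpha>2 \<alpha>3 x3 x2 l2 l3] vertex assms by (simp add: B F_def)
  qed (use that in simp)
  define S where "S = (\<lambda>\<alpha>0 \<alpha>1 k. scaled_jacobi \<alpha>0 \<alpha>1 k (1 - x2 - x3) x1)"
  have K: "koornwinder (int l1, k2, k3) (\<alpha>0, \<alpha>1, \<alpha>2, \<alpha>3) x = S \<alpha>0 \<alpha>1 (int l1) * F A \<alpha>2 k2 k3"
    "koornwinder (int l1, k2, k3) (\<alpha>0, \<alpha>1, \<alpha>2 + 1, \<alpha>3) x = S \<alpha>0 \<alpha>1 (int l1) * F A (\<alpha>2 + 1) k2 k3"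
    "koornwinder (int l1, k2, k3) (\<alpha>0 + 1, \<alpha>1, \<alpha>2, \<alpha>3) x = S (\<alpha>0 + 1) \<alpha>1 (int l1) * F (A + 1) \<alpha>2 k2 k3"
    "koornwinder (int l1 - 1, k2, k3) (\<alpha>0 + 1, \<alpha>1, \<alpha>2, \<alpha>3) x = S (\<alpha>0 + 1) \<alpha>1 (int l1 - 1) * F (A - 1) \<alpha>2 k2 k3"
    "koornwinder (int l1, k2, k3) (\<alpha>0, \<alpha>1 + 1, \<alpha>2, \<alpha>3) x = S \<alpha>0 (\<alpha>1 + 1) (int l1) * F (A + 1) \<alpha>2 k2 k3"
    "koornwinder (int l1 - 1, k2, k3) (\<alpha>0, \<alpha>1 + 1, \<alpha>2, \<alpha>3) x = S \<alpha>0 (\<alpha>1 + 1) (int l1 - 1) * F (A - 1) \<alpha>2 k2 k3"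
    for k2 k3
    by (simp_all add: koornwinder_eq_inner_factors x F_def S_def A_def algebra_simps)
  \<comment> \<open>Raising \<open>\<alpha>0\<close> or \<open>\<alpha>1\<close> in the first factor. The leftover \<open>1 - x2 - x3\<close> is grouped with the inner factors,
    which absorb it by \<open>lower\<close>.\<close>
  have K1: "koornwinder (int l1, int l2, int l3) (\<alpha>0, \<alpha>1, \<alpha>2, \<alpha>3) x =
      b1 \<alpha>0 \<alpha>1 (int l1) * S (\<alpha>0 + 1) \<alpha>1 (int l1) * F A \<alpha>2 (int l2) (int l3)
      + S (\<alpha>0 + 1) \<alpha>1 (int l1 - 1) * (b2 \<alpha>0 \<alpha>1 (int l1) * ((1 - x2 - x3) * F A \<alpha>2 (int l2) (int l3)))"
    unfolding K S_def using assms by (subst scaled_jacobi_raise_left) (simp_all add: algebra_simps)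
  have K2: "koornwinder (int l1, int l2, int l3) (\<alpha>0, \<alpha>1, \<alpha>2, \<alpha>3) x =
      b1 \<alpha>0 \<alpha>1 (int l1) * S \<alpha>0 (\<alpha>1 + 1) (int l1) * F A \<alpha>2 (int l2) (int l3)
      + S \<alpha>0 (\<alpha>1 + 1) (int l1 - 1) * (- b2 \<alpha>1 \<alpha>0 (int l1) * ((1 - x2 - x3) * F A \<alpha>2 (int l2) (int l3)))"
    unfolding K S_def using assms by (subst scaled_jacobi_raise_right) (simp_all add: algebra_simps)
  have sum2: "(\<Sum>i = 0..1. f i) = f 0 + f 1" for f :: "nat \<Rightarrow> real"
    by (simp add: sum.atLeast0_atMost_Suc)
  note [simp] = A1.simps[of l1 l2 l3 \<alpha>0 \<alpha>1 \<alpha>2 \<alpha>3, unfolded Let_def, folded A_def B_def]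
    A2.simps[of l1 l2 l3 \<alpha>0 \<alpha>1 \<alpha>2 \<alpha>3, unfolded Let_def, folded A_def B_def]
    A3.simps[of l1 l2 l3 \<alpha>0 \<alpha>1 \<alpha>2 \<alpha>3, unfolded Let_def, folded A_def B_def]
    A4.simps[of l1 l2 l3 \<alpha>0 \<alpha>1 \<alpha>2 \<alpha>3, unfolded Let_def, folded A_def B_def]
  show ?thesis
  proof (intro conjI)
    show "koornwinder (int l1, int l2, int l3) (\<alpha>0, \<alpha>1, \<alpha>2, \<alpha>3) x =
      (\<Sum>p = 0..1. \<Sum>q = 0..1. \<Sum>r = 0..1.
         A1 (l1, l2, l3) (\<alpha>0, \<alpha>1, \<alpha>2, \<alpha>3) p q r *
         koornwinder (int l1 - int p, int l2 - (int q - int p), int l3 - (int r - int q))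
           (\<alpha>0 + 1, \<alpha>1, \<alpha>2, \<alpha>3) x)"
      unfolding K1 by (subst lower, simp, subst left)
        (simp add: sum2 K, simp add: algebra_simps)
    show "koornwinder (int l1, int l2, int l3) (\<alpha>0, \<alpha>1, \<alpha>2, \<alpha>3) x =
      (\<Sum>p = 0..1. \<Sum>q = 0..1. \<Sum>r = 0..1.
         A2 (l1, l2, l3) (\<alpha>0, \<alpha>1, \<alpha>2, \<alpha>3) p q r *
         koornwinder (int l1 - int p, int l2 - (int q - int p), int l3 - (int r - int q))
           (\<alpha>0, \<alpha>1 + 1, \<alpha>2, \<alpha>3) x)"
      unfolding K2 by (subst lower, simp, subst left)
        (simp add: sum2 K, simp add: algebra_simps)
    show "koornwinder (int l1, int l2, int l3) (\<alpha>0, \<alpha>1, \<alpha>2, \<alpha>3) x =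
      (\<Sum>q = 0..1. \<Sum>r = 0..1.
         A3 (l1, l2, l3) (\<alpha>0, \<alpha>1, \<alpha>2, \<alpha>3) q r *
         koornwinder (int l1, int l2 - int q, int l3 - (int r - int q))
           (\<alpha>0, \<alpha>1, \<alpha>2 + 1, \<alpha>3) x)"
      unfolding K(1) right
      by (simp add: sum2 K, simp add: algebra_simps)
    have K3: "koornwinder (int l1, int l2, k3) (\<alpha>0, \<alpha>1, \<alpha>2, c) x =
        S \<alpha>0 \<alpha>1 (int l1) * scaled_jacobi A \<alpha>2 (int l2) (1 - x3) x2 * scaled_jacobi B c k3 1 x3" for k3 c
      by (simp add: koornwinder_eq_inner_factors x inner_factors_def S_def B A_def[symmetric])
    have "-1 \<le> B" using A assms by (simp flip: B)
    then have raise: "scaled_jacobi B \<alpha>3 (int l3) 1 x3 =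
        b1 B \<alpha>3 (int l3) * scaled_jacobi B (\<alpha>3 + 1) (int l3) 1 x3
        - b2 \<alpha>3 B (int l3) * scaled_jacobi B (\<alpha>3 + 1) (int l3 - 1) 1 x3"
      using scaled_jacobi_raise_right[of B \<alpha>3 l3 1 x3] assms by simp
    show "koornwinder (int l1, int l2, int l3) (\<alpha>0, \<alpha>1, \<alpha>2, \<alpha>3) x =
      (\<Sum>r = 0..1.
         A4 (l1, l2, l3) (\<alpha>0, \<alpha>1, \<alpha>2, \<alpha>3) r *
         koornwinder (int l1, int l2, int l3 - int r) (\<alpha>0, \<alpha>1, \<alpha>2, \<alpha>3 + 1) x)"
      unfolding K3 raise by (simp add: sum2, simp add: algebra_simps)
  qed
qed

end
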